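(* Let $m$ be odd and let $(\mathbb{F}_{2^m},+,\diamond)$ be the Kantor pre-semifield, with multiplication $x\diamond y=x^2y+\mathrm{tr}(xy)+x\,\mathrm{tr}(y)$. Then $$\diamond\frac{y}{x}=\frac{\mathrm{tr}(x)}{x}\left[(xy)^{2^{m-1}}+\sum_{i=0}^{\frac{m-1}{2}}(xy)^{2^{2i}-1}+\left(\sum_{i=0}^{\frac{m-3}{2}}x^{2^{2i}}\right)\mathrm{tr}(xy)\right]+x^{2^{m-1}-1}y^{2^{m-1}}+x^{2^{m-1}-1}\,\mathrm{tr}(xy).$$
   Context: Here $x,y$ are variables over $\mathbb{F}_{2^m}$, and $\mathrm{tr}(x)=\sum_{i=0}^{m-1}x^{2^i}$ is the trace from $\mathbb{F}_{2^m}$ to $\mathbb{F}_2$. Pre-semifield: $(\mathbb{F}_{2^m},+,\diamond)$, with $+$ the field addition, is a pre-semifield if $\diamond$ distributes over $+$ on both sides, $0\diamond x=x\diamond 0=0$ for all $x$, and for every nonzero $a$ the maps $x\mapsto a\diamond x$ and $x\mapsto x\diamond a$ are bijections of $\mathbb{F}_{2^m}^*=\mathbb{F}_{2^m}\setminus\{0\}$ onto itself. The multiplication in the claim is known to give a pre-semifield, called the Kantor pre-semifield. Division: for $x\in\mathbb{F}_{2^m}^*$ and $y\in\mathbb{F}_{2^m}$, $\diamond\frac{y}{x}$ denotes the unique $a\in\mathbb{F}_{2^m}$ with $y=a\diamond x$; moreover $\diamond\frac{y}{0}=0$ for all $y\in\mathbb{F}_{2^m}$.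
   Formalization: The printed formula fails at x=y=1 for every odd m (quotient 1, right side 0); the sum of (xy)^{2^{2i}-1} over i=0..(m-1)/2 is replaced by the sum of (xy)^{2^{2i-1}} over i=1..(m-1)/2. The case m=1, x=0, where 0^0 occurs, is excluded. *)

theory Defs
  imports
    "HOL-Library.Cardinality"
    "HOL-Number_Theory.Number_Theory"
begin

text \<open>
  The field with \<open>2 ^ m\<close> elements is an arbitrary type \<open>'a :: finite_field\<close> with
  \<open>CARD('a) = 2 ^ m\<close>.  The trace to the prime field takes its values, 0 and 1, in
  \<open>'a\<close> itself.
\<close>

definition trace2 :: "nat \<Rightarrow> 'a::field \<Rightarrow> 'a" where
  "trace2 m x = (\<Sum>i<m. x ^ (2 ^ i))"

definition pre_semifield :: "('a::field \<Rightarrow> 'a \<Rightarrow> 'a) \<Rightarrow> bool" where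
  "pre_semifield f \<longleftrightarrow>
     (\<forall>x y z. f x (y + z) = f x y + f x z) \<and>
     (\<forall>x y z. f (x + y) z = f x z + f y z) \<and>
     (\<forall>x. f 0 x = 0 \<and> f x 0 = 0) \<and>
     (\<forall>a. a \<noteq> 0 \<longrightarrow>
        bij_betw (\<lambda>x. f a x) (- {0}) (- {0}) \<and> bij_betw (\<lambda>x. f x a) (- {0}) (- {0}))"

text \<open>\<open>psf_div f y x\<close> is the quotient of \<open>y\<close> by \<open>x\<close>, in this order.\<close>

definition psf_div :: "('a::field \<Rightarrow> 'a \<Rightarrow> 'a) \<Rightarrow> 'a \<Rightarrow> 'a \<Rightarrow> 'a" where
  "psf_div f y x = (if x = 0 then 0 else (THE a. y = f a x))"

definition kantor_mult :: "nat \<Rightarrow> 'a::field \<Rightarrow> 'a \<Rightarrow> 'a" where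
  "kantor_mult m x y = x\<^sup>2 * y + trace2 m (x * y) + x * trace2 m y"

lemma char_2:
  assumes "CARD('a::finite_field) = 2 ^ m"
  shows "CHAR('a) = 2"
proof -
  have "CHAR('a) dvd 2 ^ m" using CHAR_dvd_CARD[where 'a='a] assms by simp
  moreover have "prime CHAR('a)" by (simp add: prime_CHAR_semidom finite_imp_CHAR_pos)
  ultimately show ?thesis
    by (metis prime_dvd_power primes_dvd_imp_eq two_is_prime_nat)
qed

lemma double_0:
  assumes "CARD('a::finite_field) = 2 ^ m"
  shows "(x::'a) + x = 0"
proof -
  have "of_nat 2 = (0::'a)" using char_2[OF assms] of_nat_CHAR[where 'a='a] by simp
  then show ?thesis by (metis mult_2 mult_zero_left of_nat_numeral)
qed

lemma trace2_add:
  assumes "CARD('a::finite_field) = 2 ^ m"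
  shows "trace2 m (x + y :: 'a) = trace2 m x + trace2 m y"
proof -
  have "(x + y) ^ (2 ^ i) = x ^ (2 ^ i) + y ^ (2 ^ i)" for i
    by (rule freshmans_dream') (simp_all add: char_2[OF assms])
  then show ?thesis by (simp only: trace2_def sum.distrib)
qed

lemma trace2_0 [simp]: "trace2 m 0 = 0"
  by (simp add: trace2_def power_0_left)

lemma trace2_1: "trace2 m 1 = of_nat m"
  by (simp add: trace2_def)

lemma trace2_square:
  assumes "CARD('a::finite_field) = 2 ^ m"
  shows "trace2 m ((x::'a)\<^sup>2) = trace2 m x"
proof -
  have "trace2 m (x\<^sup>2) = (\<Sum>i<m. x ^ (2 ^ Suc i))"
    by (simp add: trace2_def power_mult)
  also have "\<dots> + x = (\<Sum>i<Suc m. x ^ (2 ^ i))"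
    by (subst sum.lessThan_Suc_shift) simp
  also have "\<dots> = trace2 m x + x"
    using finite_field_power_card_eq_same[of x] assms by (simp add: trace2_def)
  finally show ?thesis by simp
qed

lemma trace2_cases:
  assumes "CARD('a::finite_field) = 2 ^ m"
  shows "trace2 m (x::'a) = 0 \<or> trace2 m x = 1"
proof -
  have "(x ^ (2 ^ i))\<^sup>2 = (x\<^sup>2) ^ (2 ^ i)" for i
    by (metis mult.commute power_mult)
  moreover have "(trace2 m x)\<^sup>2 = (\<Sum>i<m. (x ^ (2 ^ i))\<^sup>2)"
    unfolding trace2_def by (rule freshmans_dream_sum) (simp_all add: char_2[OF assms])
  ultimately have "(trace2 m x)\<^sup>2 = trace2 m (x\<^sup>2)"
    by (simp only: trace2_def)
  then have "(trace2 m x)\<^sup>2 = trace2 m x" using trace2_square[OF assms] by simp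
  then show ?thesis by (simp add: power2_eq_square)
qed

lemma double_eq_0:
  assumes "CARD('a::finite_field) = 2 ^ m"
  shows "(x::'a) + y = 0 \<longleftrightarrow> x = y"
  by (metis double_0[OF assms] add_left_cancel)

lemma trace2_1_odd:
  assumes "CARD('a::finite_field) = 2 ^ m" "odd m"
  shows "trace2 m (1::'a) = 1"
proof -
  obtain k where "m = (k + k) + 1" using assms(2) by (metis mult_2 oddE)
  then show ?thesis
    by (simp only: trace2_1 of_nat_add double_0[OF assms(1)] of_nat_1 add_0)
qed

lemma kantor_mult_add:
  assumes "CARD('a::finite_field) = 2 ^ m"
  shows "kantor_mult m x (y + z) = kantor_mult m x y + kantor_mult m x (z::'a)"
    and "kantor_mult m (x + y) z = kantor_mult m x z + kantor_mult m y (z::'a)"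
proof -
  show "kantor_mult m x (y + z) = kantor_mult m x y + kantor_mult m x z"
    by (simp add: kantor_mult_def trace2_add[OF assms] algebra_simps)
  have "(x + y)\<^sup>2 = x\<^sup>2 + y\<^sup>2 + (x * y + x * y)"
    by (simp add: power2_eq_square algebra_simps)
  also have "\<dots> = x\<^sup>2 + y\<^sup>2" by (simp only: double_0[OF assms] add_0_right)
  finally show "kantor_mult m (x + y) z = kantor_mult m x z + kantor_mult m y z"
    by (simp add: kantor_mult_def trace2_add[OF assms] algebra_simps)
qed

lemma kantor_mult_eq_0:
  assumes card: "CARD('a::finite_field) = 2 ^ m" and odd: "odd m"
    and eq: "kantor_mult m x y = (0::'a)"
  shows "x = 0 \<or> y = 0"
proof (rule ccontr)
  assume "\<not> ?thesis"
  then have nz: "x \<noteq> 0" "y \<noteq> 0" by auto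
  note sq = trace2_square[OF card] and add = trace2_add[OF card]
    and one = trace2_1_odd[OF card odd] and dbl = double_0[OF card]
  have "y * kantor_mult m x y = 0" using eq by simp
  then have main: "(x * y)\<^sup>2 + y * trace2 m (x * y) + x * y * trace2 m y = 0"
    by (simp add: kantor_mult_def power2_eq_square algebra_simps)
  then have tr: "trace2 m ((x * y)\<^sup>2 + y * trace2 m (x * y) + x * y * trace2 m y) = 0"
    by simp
  consider "trace2 m y = 0" | "trace2 m y = 1" using trace2_cases[OF card] by blast
  then show False
  proof cases
    case 1
    then have "trace2 m (x * y) = 0"
      using tr trace2_cases[OF card, of "x * y"] by (auto simp: add sq)
    then show False using main 1 nz by simp
  next
    case 2
    then have "trace2 m (x * y) = 0"
      using tr trace2_cases[OF card, of "x * y"] dbl[of 1]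
      by (auto simp: add sq simp del: one_add_one)
    then have "(x * y)\<^sup>2 + x * y = 0" using main 2 by simp
    then have "x * y = 1" using nz double_eq_0[OF card] by (auto simp: power2_eq_square)
    then show False using \<open>trace2 m (x * y) = 0\<close> one by simp
  qed
qed

lemma pre_semifield_kantor_mult:
  assumes "CARD('a::finite_field) = 2 ^ m" and "odd m"
  shows "pre_semifield (kantor_mult m :: 'a \<Rightarrow> 'a \<Rightarrow> 'a)"
proof -
  let ?f = "kantor_mult m :: 'a \<Rightarrow> 'a \<Rightarrow> 'a"
  have zero: "?f 0 x = 0" "?f x 0 = 0" for x by (simp_all add: kantor_mult_def)
  have bij: "bij_betw g (- {0}) (- {0})"
    if add: "\<And>x y. g (x + y) = g x + g y" and ker: "\<And>x. g x = 0 \<longleftrightarrow> x = 0" for g :: "'a \<Rightarrow> 'a"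
  proof -
    have "inj g"
      by (rule injI) (metis add ker double_eq_0[OF assms(1)])
    then have "surj g" by (simp add: finite_UNIV_inj_surj)
    then have "g ` (- {0}) = - {0}"
      using ker by (auto simp: surj_def image_iff)
    then show ?thesis
      using \<open>inj g\<close> by (auto simp: bij_betw_def intro: inj_on_subset)
  qed
  have "bij_betw (\<lambda>x. ?f a x) (- {0}) (- {0})" "bij_betw (\<lambda>x. ?f x a) (- {0}) (- {0})"
    if "a \<noteq> 0" for a
    using that kantor_mult_eq_0[OF assms] zero
    by (auto intro!: bij simp: kantor_mult_add[OF assms(1)])
  then show ?thesis
    unfolding pre_semifield_def using zero kantor_mult_add[OF assms(1)] by blast
qed

text \<open>
  The source states the quotient formula with \<open>(x * y) ^ (2 ^ (2 * i) - 1)\<close> summed over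
  \<open>i = 0..(m - 1) div 2\<close>.  That version fails at \<open>x = y = 1\<close> for every odd \<open>m\<close>: the quotient
  is 1, while the right-hand side is 0.  Presumably the \<open>- 1\<close> is misplaced: the identity holds with the sum of
  \<open>(x * y) ^ (2 ^ (2 * i - 1))\<close> over \<open>i = 1..(m - 1) div 2\<close>.  Indeed, if \<open>trace2 m x = 1\<close> and
  \<open>y\<close> is the product of \<open>a\<close> and \<open>x\<close>, then \<open>z = a * x\<close> satisfies
  \<open>z\<^sup>2 + z = x * y + x * trace2 m (x * y)\<close> and \<open>trace2 m z = trace2 m (x * y)\<close>, and the solution of
  these two equations is the corrected formula multiplied by \<open>x\<close>.

  A second, degenerate point: for \<open>m = 1\<close> the exponent \<open>2 ^ (m - 1) - 1\<close> is 0, and with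
  \<open>0 ^ 0 = 1\<close> the formula would give \<open>y\<close> instead of 0 at \<open>x = 0\<close>.
\<close>

lemma stated_quotient_formula_fails:
  fixes x y :: "'a::finite_field"
  assumes card: "CARD('a) = 2 ^ m" and odd: "odd m" and xy: "x = 1" "y = 1"
  shows "psf_div (kantor_mult m) y x = 1"
    and "trace2 m x / x *
      ((x * y) ^ (2 ^ (m - 1))
       + (\<Sum>i = 0..(m - 1) div 2. (x * y) ^ (2 ^ (2 * i) - 1))
       + (\<Sum>i<(m - 1) div 2. x ^ (2 ^ (2 * i))) * trace2 m (x * y))
    + x ^ (2 ^ (m - 1) - 1) * y ^ (2 ^ (m - 1))
    + x ^ (2 ^ (m - 1) - 1) * trace2 m (x * y) = 0"
proof -
  note one = trace2_1_odd[OF card odd] and dbl = double_0[OF card]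
  have k11: "kantor_mult m 1 (1::'a) = 1"
    using dbl[of 1] by (simp add: kantor_mult_def one del: one_add_one)
  have "a = 1" if "1 = kantor_mult m a (1::'a)" for a
  proof -
    have "kantor_mult m (a + 1) 1 = 0"
      by (simp only: kantor_mult_add[OF card] k11 that[symmetric] dbl)
    then show ?thesis
      using kantor_mult_eq_0[OF card odd] double_eq_0[OF card] by (metis one_neq_zero)
  qed
  then show "psf_div (kantor_mult m) y x = 1"
    using k11 by (auto simp: psf_div_def xy)
  define k where "k = (of_nat ((m - 1) div 2) :: 'a)"
  have "1 * (1 + (k + 1) + k * 1) + 1 + 1 = (k + k) + (1 + 1) + (1 + (1::'a))"
    by (simp only: mult_1 mult_1_right ac_simps)
  also have "\<dots> = 0"
    by (simp only: dbl add_0)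
  finally show "trace2 m x / x *
      ((x * y) ^ (2 ^ (m - 1))
       + (\<Sum>i = 0..(m - 1) div 2. (x * y) ^ (2 ^ (2 * i) - 1))
       + (\<Sum>i<(m - 1) div 2. x ^ (2 ^ (2 * i))) * trace2 m (x * y))
    + x ^ (2 ^ (m - 1) - 1) * y ^ (2 ^ (m - 1))
    + x ^ (2 ^ (m - 1) - 1) * trace2 m (x * y) = 0"
    by (simp only: xy one mult_1 mult_1_right power_one div_by_1 sum_constant card_lessThan
        card_atLeastAtMost k_def of_nat_add of_nat_Suc diff_zero add.commute)
qed

end

(* For x \<noteq> 0 put z = a * x, w = x * y, and T = tr w.  Multiplying y = a \<diamond> x by x turns it into
   z^2 + x tr z + z tr x = w.  If tr x = 0, the solution is z = sqrt w + T sqrt x.  If tr x = 1,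
   the equation is z^2 + z = w + T x with tr z = T.  It is solved by z = S + T R, where S is the
   sum of w^(2^j) over the odd j < m and R is the sum of x^(2^j) over the even j < m: squaring
   shifts the exponents, so S^2 + S = T + w and R^2 + R = 1 + x. *)

theory Submission
  imports Defs
begin

lemma trace2_sum:
  assumes "CARD('a::finite_field) = 2 ^ m"
  shows "trace2 m (\<Sum>i\<in>A. f i :: 'a) = (\<Sum>i\<in>A. trace2 m (f i))"
  by (induction A rule: infinite_finite_induct) (simp_all add: trace2_add[OF assms])

lemma trace2_power_two_power:
  assumes "CARD('a::finite_field) = 2 ^ m"
  shows "trace2 m ((x::'a) ^ (2 ^ n)) = trace2 m x"
proof (induction n)
  case (Suc n)
  have "x ^ (2 ^ Suc n) = (x ^ (2 ^ n))\<^sup>2" by (simp add: mult.commute flip: power_mult)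
  then show ?case using Suc trace2_square[OF assms] by simp
qed simp

lemma square_add:
  assumes "CARD('a::finite_field) = 2 ^ m"
  shows "(x + y :: 'a)\<^sup>2 = x\<^sup>2 + y\<^sup>2"
  by (rule freshmans_dream) (simp_all add: char_2[OF assms])

text \<open>Squaring a sum is termwise in characteristic 2 and moves each exponent
  \<open>2 ^ (2 * i)\<close> to \<open>2 ^ (2 * i + 1)\<close>. The sum and its square thus
  interleave to all exponents below \<open>2 * k\<close>; \<open>trace2 (2 * k)\<close> is here only
  a power sum of that length, not the field trace.\<close>

lemma even_power_sum_square_add_self:
  assumes "CARD('a::finite_field) = 2 ^ m"
  shows "(\<Sum>i<k. (u::'a) ^ (2 ^ (2 * i)))\<^sup>2 + (\<Sum>i<k. u ^ (2 ^ (2 * i))) = trace2 (2 * k) u"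
proof (induction k)
  case 0
  show ?case by (simp add: trace2_def)
next
  case (Suc k)
  have "(u ^ (2 ^ (2 * k)))\<^sup>2 = u ^ (2 ^ Suc (2 * k))"
    by (simp add: mult.commute flip: power_mult)
  then show ?case
    using Suc by (simp add: square_add[OF assms] trace2_def ac_simps)
qed

text \<open>The hypothesis is the equation \<open>y = kantor_mult m a x\<close> multiplied by
  \<open>x\<close>, with \<open>z = a * x\<close>. The quotient is unique because two solutions add
  up to an element that annihilates \<open>x\<close>, and there are no zero divisors.\<close>

lemma psf_div_kantor_multI:
  fixes x y z :: "'a::finite_field"
  assumes card: "CARD('a) = 2 ^ m" and odd: "odd m" and "x \<noteq> 0"
    and eq: "z\<^sup>2 + x * trace2 m z + z * trace2 m x = x * y"
  shows "psf_div (kantor_mult m) y x = z / x"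
proof -
  have y: "y = kantor_mult m (z / x) x"
  proof -
    have "x * kantor_mult m (z / x) x = x * y"
      using \<open>x \<noteq> 0\<close> eq by (simp add: kantor_mult_def power2_eq_square field_simps)
    then show ?thesis using \<open>x \<noteq> 0\<close> by simp
  qed
  have "a = z / x" if "y = kantor_mult m a x" for a
  proof -
    have "kantor_mult m (a + z / x) x = y + y"
      using that y by (simp only: kantor_mult_add(2)[OF card])
    then have "a + z / x = 0"
      using kantor_mult_eq_0[OF card odd] double_0[OF card] \<open>x \<noteq> 0\<close> by metis
    then show ?thesis using double_eq_0[OF card] by blast
  qed
  then show ?thesis
    using y \<open>x \<noteq> 0\<close> by (auto simp: psf_div_def intro!: the_equality)
qed

text \<open>The exponent \<open>2 ^ (m - 1)\<close> gives the square root. Since the root of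
  \<open>x\<close> has trace 0, \<open>z\<close> has the trace of \<open>w\<close>, so
  \<open>x * trace2 m z\<close> cancels the extra term of the square of \<open>z\<close>.\<close>

lemma kantor_equation_trace_0:
  fixes x w :: "'a::finite_field"
  assumes card: "CARD('a) = 2 ^ m" and m: "m > 0" and tx: "trace2 m x = 0"
  defines "z \<equiv> w ^ (2 ^ (m - 1)) + x ^ (2 ^ (m - 1)) * trace2 m w"
  shows "z\<^sup>2 + x * trace2 m z + z * trace2 m x = w"
proof -
  have sqrt: "(v ^ (2 ^ (m - 1)))\<^sup>2 = v" for v :: 'a
  proof -
    have "(v ^ (2 ^ (m - 1)))\<^sup>2 = v ^ (2 ^ Suc (m - 1))"
      by (simp add: mult.commute flip: power_mult)
    then show ?thesis using finite_field_power_card_eq_same[of v] card m by simp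
  qed
  note simps = z_def square_add[OF card] trace2_add[OF card] trace2_power_two_power[OF card] sqrt tx
  consider "trace2 m w = 0" | "trace2 m w = 1" using trace2_cases[OF card] by blast
  then show ?thesis
  proof cases
    case 2
    have "z\<^sup>2 + x * trace2 m z + z * trace2 m x = w + (x + x)"
      by (simp add: simps 2 del: One_nat_def)
    then show ?thesis by (simp only: double_0[OF card] add_0_right)
  qed (simp add: simps del: One_nat_def)
qed

text \<open>Starting from the square of \<open>w\<close> puts the first sum on the odd exponents
  below \<open>m\<close>; the second runs over the even ones, from 0 to
  \<open>2 * k = m - 1\<close>.\<close>

lemma kantor_equation_trace_1:
  fixes x w :: "'a::finite_field"
  assumes card: "CARD('a) = 2 ^ m" and m: "m = Suc (2 * k)" and tx: "trace2 m x = 1"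
  defines "z \<equiv> (\<Sum>i<k. (w\<^sup>2) ^ (2 ^ (2 * i))) + (\<Sum>i<Suc k. x ^ (2 ^ (2 * i))) * trace2 m w"
  shows "z\<^sup>2 + x * trace2 m z + z * trace2 m x = w"
proof -
  define S where "S = (\<Sum>i<k. (w\<^sup>2) ^ (2 ^ (2 * i)))"
  define R where "R = (\<Sum>i<Suc k. x ^ (2 ^ (2 * i)))"
  note dbl = double_0[OF card]
  have "S\<^sup>2 + S = (\<Sum>i<2 * k. w ^ (2 ^ Suc i))"
    using even_power_sum_square_add_self[OF card, of "w\<^sup>2" k]
    by (simp add: S_def trace2_def power_mult)
  \<comment> \<open>Adding \<open>w\<close> supplies the term of index 0 that the shifted sum
    lacks.\<close>
  also have "\<dots> + w = trace2 m w"
    unfolding trace2_def m by (subst sum.lessThan_Suc_shift) simp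
  finally have S: "S\<^sup>2 + S = trace2 m w + w"
    by (metis add.assoc add_0_right dbl)
  have "R\<^sup>2 + R = trace2 (Suc m) x"
    using even_power_sum_square_add_self[OF card, of x "Suc k"] by (simp add: R_def m)
  \<comment> \<open>Beyond the trace of \<open>x\<close> there is one more term, of index
    \<open>m\<close>, which is \<open>x\<close> again.\<close>
  also have "\<dots> = 1 + x"
    using finite_field_power_card_eq_same[of x] card tx by (simp add: trace2_def)
  finally have R: "R\<^sup>2 + R = 1 + x" .
  \<comment> \<open>Every summand has the trace of its base. \<open>S\<close> has \<open>k\<close>
    terms and \<open>R\<close> has one more, so for \<open>trace2 m w = 1\<close> the trace of
    \<open>S + R\<close> is 1 whatever the parity of \<open>k\<close>.\<close>
  have trS: "trace2 m S = of_nat k * trace2 m w"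
    by (simp only: S_def trace2_sum[OF card] trace2_power_two_power[OF card]
        trace2_square[OF card] sum_constant card_lessThan)
  have trR: "trace2 m R = of_nat k + 1"
    by (simp only: R_def trace2_sum[OF card] trace2_power_two_power[OF card] tx
        sum_constant card_lessThan of_nat_Suc mult_1_right add.commute)
  have z: "z = S + R * trace2 m w" by (simp only: z_def S_def R_def)
  consider "trace2 m w = 0" | "trace2 m w = 1" using trace2_cases[OF card] by blast
  then show ?thesis
  proof cases
    case 1
    then show ?thesis using S trS by (simp add: z tx)
  next
    case 2
    have "trace2 m z = (of_nat k + of_nat k) + 1"
      by (simp add: z 2 trace2_add[OF card] trS trR)
    then have "trace2 m z = 1" by (simp only: dbl add_0)
    then have "z\<^sup>2 + x * trace2 m z + z * trace2 m x = (S\<^sup>2 + S) + (R\<^sup>2 + R) + x"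
      by (simp add: z tx 2 square_add[OF card])
    also have "\<dots> = w + (1 + 1) + (x + x)"
      by (simp only: S R 2) (simp only: ac_simps)
    finally show ?thesis by (simp only: dbl add_0_right)
  qed
qed

theorem theorem4p6:
  fixes x y :: "'a :: finite_field" and m :: nat
  assumes "odd m"
    and "CARD('a) = 2 ^ m"
    and "m = 1 \<Longrightarrow> x \<noteq> 0"
  shows "psf_div (kantor_mult m) y x =
    trace2 m x / x *
      ((x * y) ^ (2 ^ (m - 1))
       + (\<Sum>i = 1..(m - 1) div 2. (x * y) ^ (2 ^ (2 * i - 1)))
       + (\<Sum>i<(m - 1) div 2. x ^ (2 ^ (2 * i))) * trace2 m (x * y))
    + x ^ (2 ^ (m - 1) - 1) * y ^ (2 ^ (m - 1))
    + x ^ (2 ^ (m - 1) - 1) * trace2 m (x * y)"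
    (is "_ = ?a")
proof (cases "x = 0")
  case True
  \<comment> \<open>At \<open>x = 0\<close> the quotient is 0 by convention. For
    \<open>m > 1\<close> the exponent \<open>2 ^ (m - 1) - 1\<close> is positive, so the last two
    terms vanish and no \<open>0 ^ 0\<close> arises.\<close>
  have "m > 1" using assms(1,3) True by (cases m) auto
  then have "(2::nat) ^ (m - 1) > 1" by (intro one_less_power) auto
  then show ?thesis using True by (simp add: psf_div_def power_0_left)
next
  case False
  note card = assms(2) and odd = assms(1)
  obtain k where m: "m = Suc (2 * k)" using odd by (metis oddE Suc_eq_plus1)
  define w where "w = x * y"
  define q where "q = (2::nat) ^ (m - 1)"
  define S where "S = (\<Sum>i<k. (w\<^sup>2) ^ (2 ^ (2 * i)))"
  define E where "E = (\<Sum>i<k. x ^ (2 ^ (2 * i)))"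
  \<comment> \<open>Counting from 0 turns the exponents \<open>2 * i - 1\<close> into
    \<open>2 * i + 1\<close>, the form in which \<open>S\<close> is written.\<close>
  have "(\<Sum>i = 1..(m - 1) div 2. w ^ (2 ^ (2 * i - 1))) = (\<Sum>i<k. w ^ (2 ^ (2 * Suc i - 1)))"
    by (simp add: m sum.atLeast1_atMost_eq)
  also have "\<dots> = S" by (simp add: S_def power_mult)
  finally have S: "(\<Sum>i = 1..(m - 1) div 2. w ^ (2 ^ (2 * i - 1))) = S" .
  have "x * x ^ (q - 1) = x ^ q"
    by (simp add: q_def flip: power_Suc)
  moreover have "?a = trace2 m x / x * (w ^ q + S + E * trace2 m w)
      + x ^ (q - 1) * y ^ q + x ^ (q - 1) * trace2 m w"
    unfolding w_def[symmetric] q_def[symmetric] S by (simp add: E_def m)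
  \<comment> \<open>The factor \<open>x\<close> clears the denominator and completes both powers
    \<open>x ^ (q - 1)\<close>; together with \<open>y ^ q\<close> the first becomes
    \<open>w ^ q\<close>.\<close>
  ultimately have a: "x * ?a = trace2 m x * (w ^ q + S + E * trace2 m w)
      + w ^ q + x ^ q * trace2 m w"
    using False by (simp add: w_def power_mult_distrib distrib_left flip: mult.assoc)
  consider "trace2 m x = 0" | "trace2 m x = 1" using trace2_cases[OF card] by blast
  then have "(x * ?a)\<^sup>2 + x * trace2 m (x * ?a) + (x * ?a) * trace2 m x = w"
  proof cases
    case 1
    show ?thesis
      unfolding a using kantor_equation_trace_0[OF card odd_pos[OF odd] 1, of w]
      by (simp add: 1 q_def)
  next
    case 2
    \<comment> \<open>Now \<open>w ^ q\<close> occurs twice and cancels, while \<open>x ^ q\<close>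
      is the term of index \<open>i = k\<close> missing from \<open>E\<close>.\<close>
    have "x * ?a = S + (E + x ^ q) * trace2 m w + (w ^ q + w ^ q)"
      unfolding a by (simp add: 2 algebra_simps)
    also have "\<dots> = S + (\<Sum>i<Suc k. x ^ (2 ^ (2 * i))) * trace2 m w"
      by (simp only: double_0[OF card] add_0_right) (simp add: E_def q_def m)
    finally show ?thesis
      using kantor_equation_trace_1[OF card m 2, of w] by (simp only: S_def)
  qed
  then show ?thesis
    using psf_div_kantor_multI[OF card odd False, of "x * ?a" y] False by (simp add: w_def)
qed

end
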